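(* Consider a rotationally symmetric map $\varphi:B^n\to S^n\subset\mathbb{R}^{n+1}$ of the form $\varphi(r,\theta)=(\rho(r),\theta)$ with $\rho(1)=\pi/2$, in the coordinates described in the context. Then $\varphi$ is an infinity-harmonic map if and only if either (a) $\rho\equiv\pi/2$ and $\varphi$ is the equator map $\varphi:B^n\setminus\{0\}\to S^{n-1}\subset S^n$, $\varphi(x)=x/|x|$; or (b) $\rho$ satisfies the ordinary differential equation $$\rho'^2+\frac{n-1}{r^2}\sin^2\rho=\text{constant},$$ and $\varphi$ has constant energy density.
   Context: $B^n$ is the unit ball in $\mathbb{R}^n$ with the Euclidean metric and polar coordinates $(r,\theta)$, $\theta\in S^{n-1}$, $0<r\le1$, so the metric is $dr^2+r^2d\theta^2$. $S^n$ is the unit sphere with geodesic coordinates $(\rho,\phi)$, where $\rho$ is the distance from the north pole and $\phi\in S^{n-1}$, so the metric is $d\rho^2+\sin^2\rho\,d\phi^2$. The sphere $S^{n-1}\subset S^n$ is the equator $\rho=\pi/2$, and $\mathbb{R}^n$ is embedded in $\mathbb{R}^{n+1}$ by $(x^1,\dots,x^n)\mapsto(x^1,\dots,x^n,0)$. The map $\varphi$ is assumed $C^2$ and is considered in these polar coordinates, i.e. away from the origin. A $C^2$ map $\psi:(M,g)\to(N,h)$ between Riemannian manifolds is infinity-harmonic if $\frac12\, d\psi(\mathrm{grad}\,|d\psi|^2)=0$, where $|d\psi|_x^2=\sum_i h(d\psi(e_i),d\psi(e_i))$ for an orthonormal basis $\{e_i\}$ of $T_xM$; $|d\psi|^2$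 is called the energy density. *)

theory Defs
  imports "HOL-Analysis.Analysis"
begin

text \<open>
  The domain \<open>M\<close> is a subset of a Euclidean space with the flat metric, and the target \<open>N\<close> is a
  submanifold of a Euclidean space with the induced metric, so that the differential of a map
  into \<open>N\<close> takes values in the ambient space and its vectors are measured by the ambient norm.

  All derivatives are taken within \<open>M\<close>: they are the usual ones at interior points and one-sided
  at boundary points.  They are unique for sets such as the punctured closed ball; nothing here is
  meant for \<open>M\<close> of positive codimension, where \<^term>\<open>frechet_derivative\<close> would be ambiguous.
\<close>

definition C2_on :: "('a::euclidean_space \<Rightarrow> 'b::euclidean_space) \<Rightarrow> 'a set \<Rightarrow> bool" where
  "C2_on f M \<longleftrightarrow>
     (\<exists>(f' :: 'a \<Rightarrow> 'a \<Rightarrow>\<^sub>L 'b) (f'' :: 'a \<Rightarrow> 'a \<Rightarrow>\<^sub>L ('a \<Rightarrow>\<^sub>L 'b)).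
        (\<forall>x\<in>M. (f has_derivative blinfun_apply (f' x)) (at x within M)) \<and>
        (\<forall>x\<in>M. (f' has_derivative blinfun_apply (f'' x)) (at x within M)) \<and>
        continuous_on M f'')"

definition differential ::
    "'a::euclidean_space set \<Rightarrow> ('a \<Rightarrow> 'b::euclidean_space) \<Rightarrow> 'a \<Rightarrow> 'a \<Rightarrow> 'b" where
  "differential M \<psi> x = frechet_derivative \<psi> (at x within M)"

definition grad :: "'a::euclidean_space set \<Rightarrow> ('a \<Rightarrow> real) \<Rightarrow> 'a \<Rightarrow> 'a" where
  "grad M u x = (THE v. \<forall>h. v \<bullet> h = differential M u x h)"

definition energy_density ::
    "'a::euclidean_space set \<Rightarrow> ('a \<Rightarrow> 'b::euclidean_space) \<Rightarrow> 'a \<Rightarrow> real" where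
  "energy_density M \<psi> x = (\<Sum>e\<in>Basis. differential M \<psi> x e \<bullet> differential M \<psi> x e)"

definition infinity_harmonic ::
    "'a::euclidean_space set \<Rightarrow> 'b::euclidean_space set \<Rightarrow> ('a \<Rightarrow> 'b) \<Rightarrow> bool" where
  "infinity_harmonic M N \<psi> \<longleftrightarrow>
     C2_on \<psi> M \<and> \<psi> ` M \<subseteq> N \<and>
     (\<forall>x\<in>M. (1/2) *\<^sub>R differential M \<psi> x (grad M (energy_density M \<psi>) x) = 0)"

abbreviation punctured_ball :: "'a::euclidean_space set" where
  "punctured_ball \<equiv> cball 0 1 - {0}"

text \<open>
  The space \<open>\<real>\<^sup>n\<^sup>+\<^sup>1\<close> is \<^typ>\<open>(real ^ 'n) \<times> real\<close>, whose product norm is Euclidean, with north pole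
  \<^term>\<open>(0, 1)\<close>.  The point with geodesic coordinates \<open>(\<rho>, \<theta>)\<close> is reached from the north pole
  after length \<open>\<rho>\<close> along the unit speed great circle with initial direction \<open>\<theta>\<close>.
\<close>

definition geodesic_point :: "real \<Rightarrow> real ^ 'n \<Rightarrow> (real ^ 'n) \<times> real" where
  "geodesic_point \<rho> \<theta> = (sin \<rho> *\<^sub>R \<theta>, cos \<rho>)"

definition embed_Rn :: "real ^ 'n \<Rightarrow> (real ^ 'n) \<times> real" where
  "embed_Rn x = (x, 0)"

end

theory Submission
  imports Defs
begin

text \<open>
  Write \<open>E(r) = \<rho>'\<^sup>2 + (n - 1) sin\<^sup>2 \<rho> / r\<^sup>2\<close>.  For a rotationally symmetric map the energy density at
  \<open>x\<close> is \<open>E(|x|)\<close> (\<open>energy_density_symmetric_map\<close>), so its gradient is \<open>E' \<partial>\<^sub>r\<close>; since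
  \<open>d\<phi>(\<partial>\<^sub>r)\<close> is \<open>\<rho>'\<close> times a unit vector, the map is infinity-harmonic if and only if
  \<open>\<rho>' E' = 0\<close> on \<open>(0,1]\<close> (\<open>infinity_harmonic_symmetric_map_iff\<close>).

  It remains to see that \<open>\<rho>' E' = 0\<close> forces \<open>\<rho>' \<equiv> 0\<close> or \<open>E\<close> constant, that is, that the two
  alternatives cannot be glued along the interval (\<open>constant_profile_or_constant_energy\<close>).  If
  \<open>\<rho>'\<close> vanishes nowhere, then \<open>E' \<equiv> 0\<close>.  Otherwise suppose \<open>\<rho>'(u) \<noteq> 0\<close> and let \<open>s\<close> be a zero of
  \<open>\<rho>'\<close> such that there is no other between \<open>u\<close> and \<open>s\<close>.  Between them \<open>E\<close> is constant, hence
  \<open>E'(s) = 0\<close>.  As \<open>\<rho>'(s) = 0\<close>, the derivative is \<open>E'(s) = - 2 (n - 1) sin\<^sup>2 \<rho>(s) / s\<^sup>3\<close>, so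
  \<open>E(s) = (n - 1) sin\<^sup>2 \<rho>(s) / s\<^sup>2 = 0\<close> and therefore \<open>E(u) = 0\<close>, contradicting \<open>\<rho>'(u) \<noteq> 0\<close>.
  If \<open>\<rho>' \<equiv> 0\<close>, then \<open>\<rho> \<equiv> \<rho>(1) = \<pi>/2\<close>, which is the equator map.

  The smoothness of \<open>\<phi>\<close> passes to \<open>sin \<rho>\<close> and \<open>cos \<rho>\<close>, and from there to \<open>\<rho>\<close> because \<open>\<rho>\<close> is
  continuous (\<open>profile_twice_differentiable\<close>).
\<close>

section \<open>Uniqueness of derivatives within a set\<close>

lemma has_real_derivative_unique_connected:
  fixes f :: "real \<Rightarrow> real"
  assumes "(f has_real_derivative a) (at x within S)" "(f has_real_derivative b) (at x within S)"
    and "connected S" "x \<in> S" "y \<in> S" "x \<noteq> y"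
  shows "a = b"
proof -
  have "x islimpt S"
    using assms(3-6) by (intro connected_imp_perfect) auto
  then show ?thesis
    using assms(1,2) has_field_derivative_unique trivial_limit_within by blast
qed

text \<open>
  Two derivatives within \<open>S\<close> agree on the directions from \<open>x\<close> into \<open>S\<close>, and these span the
  space because the interior of \<open>S\<close> is not empty.
  This covers boundary points, where no coordinate direction need point into \<open>S\<close>.
\<close>

lemma has_derivative_unique_convex:
  fixes f :: "'a::real_normed_vector \<Rightarrow> 'b::real_normed_vector"
  assumes A: "(f has_derivative A) (at x within S)" and B: "(f has_derivative B) (at x within S)"
    and S: "convex S" "x \<in> S" "interior S \<noteq> {}"
  shows "A = B"
proof -
  interpret A: bounded_linear A using A by (rule has_derivative_bounded_linear)
  interpret B: bounded_linear B using B by (rule has_derivative_bounded_linear)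
  have eq: "A (y - x) = B (y - x)" if y: "y \<in> S" for y
  proof -
    let ?l = "\<lambda>t::real. x + t *\<^sub>R (y - x)"
    have img: "?l ` {0..1} \<subseteq> S"
    proof clarify
      fix t :: real assume "t \<in> {0..1}"
      then have "(1 - t) *\<^sub>R x + t *\<^sub>R y \<in> S"
        using S(1,2) y by (auto simp: convex_alt)
      then show "?l t \<in> S" by (simp add: algebra_simps)
    qed
    have l: "(?l has_derivative (\<lambda>t. t *\<^sub>R (y - x))) (at 0 within {0..1})"
      by (auto intro!: derivative_eq_intros)
    have "((\<lambda>t. f (?l t)) has_derivative (\<lambda>t. D (t *\<^sub>R (y - x)))) (at 0 within {0..1})"
      if "(f has_derivative D) (at x within S)" for D
      using has_derivative_in_compose[OF l, of f D] has_derivative_subset[OF that img] by simp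
    from this[OF A] this[OF B]
    have "((\<lambda>t. f (?l t)) has_vector_derivative A (y - x)) (at 0 within {0..1})"
      "((\<lambda>t. f (?l t)) has_vector_derivative B (y - x)) (at 0 within {0..1})"
      by (simp_all add: has_vector_derivative_def A.scaleR B.scaleR)
    then show ?thesis
      by (intro vector_derivative_unique_within_closed_interval[of 0 1 0]) auto
  qed
  obtain z e where ze: "e > 0" "ball z e \<subseteq> S"
    using S(3) by (metis all_not_in_conv mem_interior)
  show ?thesis
  proof
    fix w :: 'a
    \<comment> \<open>with this \<open>t\<close> the point \<open>z + t w\<close> stays in the ball about \<open>z\<close>, so \<open>t w\<close> is a difference of
      two directions into \<open>S\<close>\<close>
    define t where "t = e / (2 * (norm w + 1))"
    have t: "t > 0" using ze(1) by (simp add: t_def add_nonneg_pos)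
    have "t * norm w = e * (norm w / (2 * (norm w + 1)))" by (simp add: t_def)
    also have "\<dots> < e * 1"
      using ze(1) by (intro mult_strict_left_mono) (auto simp: divide_simps add_nonneg_pos intro: add_pos_nonneg)
    finally have "z + t *\<^sub>R w \<in> S" "z \<in> S"
      using ze t by (auto intro!: subsetD[OF ze(2)] simp: dist_norm)
    then have "A (z + t *\<^sub>R w - x) - A (z - x) = B (z + t *\<^sub>R w - x) - B (z - x)"
      using eq by metis
    then have "t *\<^sub>R A w = t *\<^sub>R B w"
      by (simp add: A.diff B.diff A.add B.add A.scaleR B.scaleR)
    then show "A w = B w" using t by simp
  qed
qed

lemma at_within_punctured_ball:
  assumes "x \<in> punctured_ball"
  shows "at x within punctured_ball = at x within cball 0 1"
  by (rule at_within_nhd[of _ "- {0}"]) (use assms in auto)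

lemma differential_punctured_ball:
  assumes "x \<in> punctured_ball" "(\<psi> has_derivative D) (at x within punctured_ball)"
  shows "differential punctured_ball \<psi> x = D"
proof -
  have "(\<psi> has_derivative frechet_derivative \<psi> (at x within punctured_ball))
      (at x within punctured_ball)"
    using assms(2) frechet_derivative_works differentiable_def by blast
  then show ?thesis
    unfolding differential_def using assms at_within_punctured_ball[OF assms(1)]
    by (intro has_derivative_unique_convex[of \<psi> _ x "cball 0 1"]) auto
qed

lemma grad_punctured_ball:
  assumes "x \<in> punctured_ball" "(u has_derivative (\<lambda>h. v \<bullet> h)) (at x within punctured_ball)"
  shows "grad punctured_ball u x = v"
  unfolding grad_def differential_punctured_ball[OF assms]
  by (rule the_equality) (auto intro: vector_eq_rdot[THEN iffD1])

section \<open>Rotationally symmetric maps\<close>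

lemma radial_has_derivative:
  assumes x: "x \<in> punctured_ball"
    and F: "(F has_real_derivative d) (at (norm x) within {0<..1})"
  shows "((\<lambda>y. F (norm y)) has_derivative (\<lambda>h. d * ((x /\<^sub>R norm x) \<bullet> h)))
           (at x within punctured_ball)"
proof -
  have n: "(norm has_derivative (\<lambda>h. sgn x \<bullet> h)) (at x within punctured_ball)"
    using x has_derivative_norm[of x] has_derivative_at_withinI by (fastforce simp: inner_commute)
  have "(F has_derivative (\<lambda>t. d * t)) (at (norm x) within norm ` punctured_ball)"
    using F unfolding has_field_derivative_def
    by (rule has_derivative_subset) auto
  from has_derivative_in_compose[OF n this] show ?thesis
    by (simp add: sgn_div_norm)
qed

text \<open>
  The radial component \<open>(\<theta> \<bullet> h) \<theta>\<close> of \<open>h\<close> is sent to \<open>\<rho>' (\<theta> \<bullet> h)\<close> times the unit tangent vector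
  \<open>(cos \<rho> \<theta>, - sin \<rho>)\<close> of the meridian; the orthogonal component is scaled by \<open>sin \<rho> / r\<close>.
\<close>

lemma symmetric_map_has_derivative:
  fixes \<phi> :: "real ^ 'n \<Rightarrow> (real ^ 'n) \<times> real" and x :: "real ^ 'n"
  assumes x: "x \<in> punctured_ball"
    and \<phi>: "\<And>y. y \<in> punctured_ball \<Longrightarrow> \<phi> y = geodesic_point (\<rho> (norm y)) (y /\<^sub>R norm y)"
    and \<rho>: "(\<rho> has_real_derivative d) (at (norm x) within {0<..1})"
  defines "\<theta> \<equiv> x /\<^sub>R norm x"
  shows "(\<phi> has_derivative (\<lambda>h.
            ((d * cos (\<rho> (norm x)) * (\<theta> \<bullet> h)) *\<^sub>R \<theta>
               + (sin (\<rho> (norm x)) / norm x) *\<^sub>R (h - (\<theta> \<bullet> h) *\<^sub>R \<theta>),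
             - (d * sin (\<rho> (norm x)) * (\<theta> \<bullet> h))))) (at x within punctured_ball)"
proof -
  let ?r = "norm x"
  have r: "?r \<noteq> 0" using x by auto
  have s: "((\<lambda>r. sin (\<rho> r) / r) has_real_derivative
      (d * cos (\<rho> ?r) * ?r - sin (\<rho> ?r)) / ?r\<^sup>2) (at ?r within {0<..1})"
    using r by (auto intro!: derivative_eq_intros \<rho> simp: power2_eq_square field_simps)
  have c: "((\<lambda>r. cos (\<rho> r)) has_real_derivative (- (d * sin (\<rho> ?r)))) (at ?r within {0<..1})"
    by (auto intro!: derivative_eq_intros \<rho>)
  have s': "((\<lambda>y. (sin (\<rho> (norm y)) / norm y) *\<^sub>R y) has_derivative
      (\<lambda>h. (d * cos (\<rho> ?r) * (\<theta> \<bullet> h)) *\<^sub>R \<theta> + (sin (\<rho> ?r) / ?r) *\<^sub>R (h - (\<theta> \<bullet> h) *\<^sub>R \<theta>)))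
      (at x within punctured_ball)"
  proof (rule has_derivative_eq_rhs[OF has_derivative_scaleR[OF radial_has_derivative[OF x s] has_derivative_ident]], rule ext)
    fix h
    have *: "x = ?r *\<^sub>R \<theta>" using r by (simp add: \<theta>_def)
    show "(sin (\<rho> ?r) / ?r) *\<^sub>R h + ((d * cos (\<rho> ?r) * ?r - sin (\<rho> ?r)) / ?r\<^sup>2 * ((x /\<^sub>R ?r) \<bullet> h)) *\<^sub>R x
       = (d * cos (\<rho> ?r) * (\<theta> \<bullet> h)) *\<^sub>R \<theta> + (sin (\<rho> ?r) / ?r) *\<^sub>R (h - (\<theta> \<bullet> h) *\<^sub>R \<theta>)"
    proof -
      have "(sin (\<rho> ?r) / ?r) *\<^sub>R h + ((d * cos (\<rho> ?r) * ?r - sin (\<rho> ?r)) / ?r\<^sup>2 * (\<theta> \<bullet> h)) *\<^sub>R (?r *\<^sub>R \<theta>)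
        = (d * cos (\<rho> ?r) * (\<theta> \<bullet> h)) *\<^sub>R \<theta> + (sin (\<rho> ?r) / ?r) *\<^sub>R (h - (\<theta> \<bullet> h) *\<^sub>R \<theta>)"
        using r by (simp add: algebra_simps power2_eq_square diff_divide_distrib)
      then show ?thesis unfolding *[symmetric] unfolding \<theta>_def .
    qed
  qed
  show ?thesis
    by (rule has_derivative_transform[OF x _ has_derivative_Pair[OF s' has_derivative_eq_rhs[OF radial_has_derivative[OF x c]]]])
      (auto simp: \<phi> geodesic_point_def \<theta>_def divide_inverse)
qed

text \<open>
  The energy density as a function of the radius, for a profile \<open>\<rho>\<close> with derivative \<open>\<rho>'\<close>; the
  parameter \<open>m\<close> is the number \<open>n - 1\<close> of angular directions.
\<close>

definition radial_energy :: "real \<Rightarrow> (real \<Rightarrow> real) \<Rightarrow> (real \<Rightarrow> real) \<Rightarrow> real \<Rightarrow> real" where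
  "radial_energy m \<rho> \<rho>' r = (\<rho>' r)\<^sup>2 + m / r\<^sup>2 * (sin (\<rho> r))\<^sup>2"

lemma radial_energy_has_derivative:
  assumes "r \<in> {0<..1}" "(\<rho> has_real_derivative \<rho>' r) (at r within {0<..1})"
    and "(\<rho>' has_real_derivative d) (at r within {0<..1})"
  shows "(radial_energy m \<rho> \<rho>' has_real_derivative
     2 * \<rho>' r * d + 2 * m * sin (\<rho> r) * cos (\<rho> r) * \<rho>' r / r\<^sup>2 - 2 * m * (sin (\<rho> r))\<^sup>2 / r ^ 3)
     (at r within {0<..1})"
  unfolding radial_energy_def[abs_def] using assms(1)
  by (auto intro!: derivative_eq_intros assms simp: field_simps power2_eq_square power3_eq_cube power4_eq_xxxx)

lemma energy_density_symmetric_map: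
  fixes \<phi> :: "real ^ 'n \<Rightarrow> (real ^ 'n) \<times> real" and x :: "real ^ 'n"
  assumes x: "x \<in> punctured_ball"
    and \<phi>: "\<And>y. y \<in> punctured_ball \<Longrightarrow> \<phi> y = geodesic_point (\<rho> (norm y)) (y /\<^sub>R norm y)"
    and \<rho>: "(\<rho> has_real_derivative \<rho>' (norm x)) (at (norm x) within {0<..1})"
  shows "energy_density punctured_ball \<phi> x = radial_energy (real CARD('n) - 1) \<rho> \<rho>' (norm x)"
proof -
  let ?r = "norm x"
  define \<theta> where "\<theta> = x /\<^sub>R ?r"
  define a where "a = \<rho>' ?r * cos (\<rho> ?r)"
  define b where "b = sin (\<rho> ?r) / ?r"
  define c where "c = \<rho>' ?r * sin (\<rho> ?r)"
  have r: "?r \<noteq> 0" using x by auto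
  have \<theta>1: "\<theta> \<bullet> \<theta> = 1" using r by (simp add: \<theta>_def power2_norm_eq_inner[symmetric] power2_eq_square)
  have D: "differential punctured_ball \<phi> x =
      (\<lambda>h. ((a * (\<theta> \<bullet> h)) *\<^sub>R \<theta> + b *\<^sub>R (h - (\<theta> \<bullet> h) *\<^sub>R \<theta>), - (c * (\<theta> \<bullet> h))))"
    using differential_punctured_ball[OF x symmetric_map_has_derivative[OF x \<phi> \<rho>]]
    by (simp add: \<theta>_def a_def b_def c_def)
  have "energy_density punctured_ball \<phi> x =
      (\<Sum>e\<in>Basis. (a\<^sup>2 - b\<^sup>2 + c\<^sup>2) * (\<theta> \<bullet> e)\<^sup>2 + b\<^sup>2)"
    unfolding energy_density_def D
  proof (rule sum.cong[OF refl])
    fix e :: "real ^ 'n" assume "e \<in> Basis"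
    then have e: "e \<bullet> e = 1" by (simp add: inner_Basis)
    show "((a * (\<theta> \<bullet> e)) *\<^sub>R \<theta> + b *\<^sub>R (e - (\<theta> \<bullet> e) *\<^sub>R \<theta>), - (c * (\<theta> \<bullet> e))) \<bullet>
        ((a * (\<theta> \<bullet> e)) *\<^sub>R \<theta> + b *\<^sub>R (e - (\<theta> \<bullet> e) *\<^sub>R \<theta>), - (c * (\<theta> \<bullet> e)))
        = (a\<^sup>2 - b\<^sup>2 + c\<^sup>2) * (\<theta> \<bullet> e)\<^sup>2 + b\<^sup>2"
      by (simp add: inner_add inner_diff \<theta>1 e inner_commute[of e \<theta>]) algebra
  qed
  also have "\<dots> = (a\<^sup>2 - b\<^sup>2 + c\<^sup>2) * (\<Sum>e\<in>Basis. (\<theta> \<bullet> e)\<^sup>2) + real CARD('n) * b\<^sup>2"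
    by (simp add: sum.distrib sum_distrib_left)
  also have "(\<Sum>e\<in>Basis. (\<theta> \<bullet> e)\<^sup>2) = 1"
    using \<theta>1 euclidean_inner[of \<theta> \<theta>] by (simp add: power2_eq_square)
  also have "a\<^sup>2 = (\<rho>' ?r)\<^sup>2 - c\<^sup>2"
    by (simp add: a_def c_def power_mult_distrib cos_squared_eq algebra_simps)
  finally show ?thesis
    by (simp add: radial_energy_def b_def power_divide algebra_simps diff_divide_distrib)
qed

lemma infinity_harmonic_symmetric_map_iff:
  fixes \<phi> :: "real ^ 'n \<Rightarrow> (real ^ 'n) \<times> real"
  assumes C2: "C2_on \<phi> punctured_ball"
    and \<phi>: "\<And>y. y \<in> punctured_ball \<Longrightarrow> \<phi> y = geodesic_point (\<rho> (norm y)) (y /\<^sub>R norm y)"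
    and \<rho>: "\<And>r. r \<in> {0<..1} \<Longrightarrow> (\<rho> has_real_derivative \<rho>' r) (at r within {0<..1})"
    and E: "\<And>r. r \<in> {0<..1} \<Longrightarrow>
      (radial_energy (real CARD('n) - 1) \<rho> \<rho>' has_real_derivative E' r) (at r within {0<..1})"
  shows "infinity_harmonic punctured_ball (sphere 0 1) \<phi> \<longleftrightarrow> (\<forall>r\<in>{0<..1}. \<rho>' r * E' r = 0)"
proof -
  have dens: "energy_density punctured_ball \<phi> y = radial_energy (real CARD('n) - 1) \<rho> \<rho>' (norm y)"
    if "y \<in> punctured_ball" for y
    by (rule energy_density_symmetric_map) (use that \<phi> \<rho> in auto)
  have sph: "\<phi> ` punctured_ball \<subseteq> sphere 0 1"
  proof (rule image_subsetI)
    fix x :: "real ^ 'n" assume x: "x \<in> punctured_ball"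
    have "norm (sin a *\<^sub>R u, cos a) = 1" if "norm u = 1" for a and u :: "real ^ 'n"
      using that by (simp add: norm_Pair)
    from this[of "x /\<^sub>R norm x"] show "\<phi> x \<in> sphere 0 1"
      unfolding geodesic_point_def[symmetric] using \<phi>[of x] x by simp
  qed
  have tau: "differential punctured_ball \<phi> x (grad punctured_ball (energy_density punctured_ball \<phi>) x) = 0
      \<longleftrightarrow> \<rho>' (norm x) * E' (norm x) = 0" if x: "x \<in> punctured_ball" for x
  proof -
    let ?r = "norm x"
    define \<theta> where "\<theta> = x /\<^sub>R ?r"
    have r: "?r \<in> {0<..1}" using x by auto
    then have \<theta>1: "\<theta> \<bullet> \<theta> = 1"
      by (simp add: \<theta>_def power2_norm_eq_inner[symmetric] power2_eq_square)
    have "(energy_density punctured_ball \<phi> has_derivative (\<lambda>h. (E' ?r *\<^sub>R \<theta>) \<bullet> h))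
        (at x within punctured_ball)"
      by (rule has_derivative_transform[OF x dens
            has_derivative_eq_rhs[OF radial_has_derivative[OF x E[OF r]]]])
        (auto simp: \<theta>_def)
    from grad_punctured_ball[OF x this]
    have g: "grad punctured_ball (energy_density punctured_ball \<phi>) x = E' ?r *\<^sub>R \<theta>" .
    have "differential punctured_ball \<phi> x (E' ?r *\<^sub>R \<theta>) =
        ((\<rho>' ?r * cos (\<rho> ?r) * E' ?r) *\<^sub>R \<theta>, - (\<rho>' ?r * sin (\<rho> ?r) * E' ?r))"
      using differential_punctured_ball[OF x symmetric_map_has_derivative[OF x \<phi> \<rho>[OF r]]] \<theta>1
      unfolding \<theta>_def[symmetric] by simp
    moreover have "\<theta> \<noteq> 0" using \<theta>1 by auto
    moreover have "cos (\<rho> ?r) \<noteq> 0 \<or> sin (\<rho> ?r) \<noteq> 0"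
      using sin_zero_norm_cos_one[of "\<rho> ?r"] by auto
    ultimately show ?thesis
      unfolding g by (auto simp: zero_prod_def)
  qed
  obtain k :: "real ^ 'n" where k: "norm k = 1" using norm_axis_1 by blast
  have "r \<in> norm ` (punctured_ball :: (real ^ 'n) set)" if "r \<in> {0<..1}" for r
    using that k by (intro image_eqI[of _ _ "r *\<^sub>R k"]) auto
  moreover have "norm x \<in> {0<..1}" if "x \<in> punctured_ball" for x :: "real ^ 'n"
    using that by auto
  ultimately show ?thesis
    unfolding infinity_harmonic_def using C2 sph tau by (auto simp del: mult_eq_0_iff) blast+
qed

section \<open>Regularity of the profile\<close>

text \<open>
  Near \<open>x\<close>, a continuous angle is recovered from its sine and cosine by
  \<open>\<rho> r = \<rho> x + arcsin (sin (\<rho> r - \<rho> x))\<close>.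
\<close>

lemma has_real_derivative_lift_angle:
  fixes \<rho> :: "real \<Rightarrow> real"
  assumes cont: "continuous (at x within S) \<rho>" and x: "x \<in> S"
    and s: "((\<lambda>r. sin (\<rho> r)) has_real_derivative a) (at x within S)"
    and c: "((\<lambda>r. cos (\<rho> r)) has_real_derivative b) (at x within S)"
  shows "(\<rho> has_real_derivative (cos (\<rho> x) * a - sin (\<rho> x) * b)) (at x within S)"
proof -
  let ?g = "\<lambda>r. sin (\<rho> r) * cos (\<rho> x) - cos (\<rho> r) * sin (\<rho> x)"
  obtain e where e: "e > 0" "\<And>r. r \<in> S \<Longrightarrow> dist r x < e \<Longrightarrow> dist (\<rho> r) (\<rho> x) < pi / 2"
    using cont pi_half_gt_zero unfolding continuous_within_eps_delta by metis
  have g: "(?g has_real_derivative (cos (\<rho> x) * a - sin (\<rho> x) * b)) (at x within S)"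
    using DERIV_diff[OF DERIV_cmult_right[OF s, of "cos (\<rho> x)"] DERIV_cmult_right[OF c, of "sin (\<rho> x)"]]
    by (simp add: mult.commute)
  have "(arcsin has_real_derivative 1) (at (?g x))"
    using DERIV_arcsin[of 0] by (simp add: mult.commute)
  from DERIV_chain2[OF this g]
  have "((\<lambda>r. \<rho> x + arcsin (?g r)) has_real_derivative (cos (\<rho> x) * a - sin (\<rho> x) * b)) (at x within S)"
    using DERIV_add[OF DERIV_const[of "\<rho> x"]] by fastforce
  then show ?thesis
  proof (rule has_field_derivative_transform_within[OF _ e(1) x])
    fix r assume "r \<in> S" "dist r x < e"
    from e(2)[OF this] have "arcsin (sin (\<rho> r - \<rho> x)) = \<rho> r - \<rho> x"
      unfolding dist_real_def by (intro arcsin_sin) linarith+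
    then show "\<rho> x + arcsin (?g r) = \<rho> r"
      by (simp add: sin_diff)
  qed
qed

text \<open>
  Restricting \<open>\<phi>\<close> to a single ray, in the direction of a unit vector \<open>k\<close>, gives
  \<open>r \<mapsto> (sin (\<rho> r) k, cos (\<rho> r))\<close>, from which both the sine and the cosine of \<open>\<rho>\<close> can be read off.
\<close>

lemma profile_twice_differentiable:
  fixes \<phi> :: "real ^ 'n \<Rightarrow> (real ^ 'n) \<times> real"
  assumes C2: "C2_on \<phi> punctured_ball" and cont: "continuous_on {0<..1} \<rho>"
    and \<phi>: "\<And>r \<theta>. r \<in> {0<..1} \<Longrightarrow> \<theta> \<in> sphere 0 1 \<Longrightarrow> \<phi> (r *\<^sub>R \<theta>) = geodesic_point (\<rho> r) \<theta>"
  obtains \<rho>' \<rho>'' where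
    "\<And>r. r \<in> {0<..1} \<Longrightarrow> (\<rho> has_real_derivative \<rho>' r) (at r within {0<..1})"
    "\<And>r. r \<in> {0<..1} \<Longrightarrow> (\<rho>' has_real_derivative \<rho>'' r) (at r within {0<..1})"
proof -
  obtain f' :: "real ^ 'n \<Rightarrow> (real ^ 'n) \<Rightarrow>\<^sub>L ((real ^ 'n) \<times> real)" and f''
    where f': "\<And>x. x \<in> punctured_ball \<Longrightarrow> (\<phi> has_derivative blinfun_apply (f' x)) (at x within punctured_ball)"
      and f'': "\<And>x. x \<in> punctured_ball \<Longrightarrow> (f' has_derivative blinfun_apply (f'' x)) (at x within punctured_ball)"
    using C2 unfolding C2_on_def by blast
  obtain k :: "real ^ 'n" where k: "norm k = 1" using norm_axis_1 by blast
  then have kk: "k \<bullet> k = 1" by (simp add: power2_norm_eq_inner[symmetric])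
  let ?I = "{0<..1::real}"
  let ?l = "\<lambda>r::real. r *\<^sub>R k"
  have img: "?l ` ?I \<subseteq> punctured_ball" using k by auto
  have l: "(?l has_derivative (\<lambda>t. t *\<^sub>R k)) (at r within ?I)" for r
    by (auto intro!: derivative_eq_intros)
  define g where "g r = blinfun_apply (f' (?l r)) k" for r
  define \<rho>' where "\<rho>' r = cos (\<rho> r) * (fst (g r) \<bullet> k) - sin (\<rho> r) * snd (g r)" for r
  have d\<phi>: "((\<lambda>r. \<phi> (?l r)) has_derivative (\<lambda>t. t *\<^sub>R g r)) (at r within ?I)" if "r \<in> ?I" for r
    using has_derivative_in_compose2[OF f' img that l] by (simp add: g_def blinfun.scaleR_right)
  have dg: "(g has_derivative (\<lambda>t. blinfun_apply (blinfun_apply (f'' (?l r)) (t *\<^sub>R k)) k)) (at r within ?I)"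
    if "r \<in> ?I" for r
    unfolding g_def[abs_def]
    using bounded_linear.has_derivative[OF blinfun.bounded_linear_left has_derivative_in_compose2[OF f'' img that l]] .
  have \<rho>: "(\<rho> has_real_derivative \<rho>' r) (at r within ?I)" if r: "r \<in> ?I" for r
    unfolding \<rho>'_def
  proof (rule has_real_derivative_lift_angle)
    show "continuous (at r within ?I) \<rho>"
      using cont r by (simp add: continuous_on_eq_continuous_within)
    show "((\<lambda>r. sin (\<rho> r)) has_real_derivative fst (g r) \<bullet> k) (at r within ?I)"
      unfolding has_field_derivative_def
      by (rule has_derivative_transform[OF r _ has_derivative_eq_rhs[OF
              has_derivative_inner_left[OF has_derivative_fst[OF d\<phi>[OF r]], of k]]])
        (auto simp: \<phi> k kk geodesic_point_def mult.commute)
    show "((\<lambda>r. cos (\<rho> r)) has_real_derivative snd (g r)) (at r within ?I)"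
      unfolding has_field_derivative_def
      by (rule has_derivative_transform[OF r _ has_derivative_eq_rhs[OF
              has_derivative_snd[OF d\<phi>[OF r]]]])
        (auto simp: \<phi> k geodesic_point_def mult.commute)
  qed (rule r)
  have "\<rho>' differentiable (at r within ?I)" if r: "r \<in> ?I" for r
  proof -
    have dp: "\<rho> differentiable (at r within ?I)"
      using \<rho>[OF r] by (auto simp: real_differentiable_def)
    have "(\<lambda>r. sin (\<rho> r)) differentiable (at r within ?I)"
      "(\<lambda>r. cos (\<rho> r)) differentiable (at r within ?I)"
      using \<rho>[OF r] by (auto simp: real_differentiable_def intro!: exI derivative_eq_intros)
    moreover have "(\<lambda>r. fst (g r) \<bullet> k) differentiable (at r within ?I)"
      "(\<lambda>r. snd (g r)) differentiable (at r within ?I)"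
      using has_derivative_inner_left[OF has_derivative_fst[OF dg[OF r]], of k] has_derivative_snd[OF dg[OF r]]
      unfolding differentiable_def by blast+
    ultimately show ?thesis
      unfolding \<rho>'_def[abs_def] by (intro differentiable_diff differentiable_mult)
  qed
  then obtain \<rho>'' where "\<And>r. r \<in> ?I \<Longrightarrow> (\<rho>' has_real_derivative \<rho>'' r) (at r within ?I)"
    unfolding real_differentiable_def by metis
  with \<rho> show ?thesis by (rule that)
qed

section \<open>The dichotomy for the profile\<close>

text \<open>
  Only \<open>m \<ge> 0\<close> matters here: for \<open>m = 0\<close> the step from \<open>E'(s) = 0\<close> to \<open>E(s) = 0\<close> is still correct,
  as both contain \<open>sin\<^sup>2 \<rho>(s)\<close> with the factor \<open>m\<close>.
\<close>

lemma constant_profile_or_constant_energy: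
  assumes \<rho>: "\<And>r. r \<in> {0<..1} \<Longrightarrow> (\<rho> has_real_derivative \<rho>' r) (at r within {0<..1})"
    and \<rho>': "\<And>r. r \<in> {0<..1} \<Longrightarrow> (\<rho>' has_real_derivative \<rho>'' r) (at r within {0<..1})"
    and E: "\<And>r. r \<in> {0<..1} \<Longrightarrow>
        (radial_energy m \<rho> \<rho>' has_real_derivative E' r) (at r within {0<..1})"
    and m: "m \<ge> 0"
    and zero: "\<And>r. r \<in> {0<..1} \<Longrightarrow> \<rho>' r * E' r = 0"
  shows "(\<forall>r\<in>{0<..1}. \<rho>' r = 0) \<or> (\<exists>c. \<forall>r\<in>{0<..1}. radial_energy m \<rho> \<rho>' r = c)"
proof (rule disjCI)
  let ?I = "{0<..1::real}"
  let ?E = "radial_energy m \<rho> \<rho>'"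
  assume "\<not> (\<exists>c. \<forall>r\<in>?I. ?E r = c)"
  moreover have "\<exists>c. \<forall>r\<in>?I. ?E r = c" if nz: "\<forall>r\<in>?I. \<rho>' r \<noteq> 0"
  proof (rule has_field_derivative_zero_constant)
    fix r assume r: "r \<in> ?I"
    have "E' r = 0" using zero[OF r] nz r by simp
    then show "(?E has_real_derivative 0) (at r within ?I)" using E[OF r] by simp
  qed simp
  ultimately obtain z where z: "z \<in> ?I" "\<rho>' z = 0"
    by blast
  show "\<forall>r\<in>?I. \<rho>' r = 0"
  proof (rule ccontr)
    assume "\<not> (\<forall>r\<in>?I. \<rho>' r = 0)"
    then obtain u where u: "u \<in> ?I" "\<rho>' u \<noteq> 0" by blast
    define K where "K = closed_segment u z"
    have K: "K \<subseteq> ?I"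
      unfolding K_def using u z by (intro closed_segment_subset) auto
    define Z where "Z = {r \<in> K. \<rho>' r = 0}"
    have "continuous_on K \<rho>'"
      using \<rho>' K by (blast intro: continuous_on_subset DERIV_continuous_on)
    then have "closed Z" unfolding Z_def
      by (intro continuous_closed_preimage_constant)
        (auto simp: K_def)
    moreover have "Z \<noteq> {}" using z by (auto simp: Z_def K_def)
    ultimately obtain s where "s \<in> Z" and near: "\<And>y. y \<in> Z \<Longrightarrow> dist u s \<le> dist u y"
      by (rule distance_attains_inf[where a = u]) (rule that)
    then have s: "s \<in> K" "\<rho>' s = 0" by (simp_all add: Z_def)
    \<comment> \<open>\<open>s\<close> is the only zero of \<open>\<rho>'\<close> on \<open>J\<close>; segments treat \<open>s < u\<close> and \<open>s > u\<close> alike\<close>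
    define J where "J = closed_segment u s"
    have JK: "J \<subseteq> K" unfolding J_def K_def
      using s by (intro closed_segment_subset) (auto simp: K_def)
    have J: "J \<subseteq> ?I" "u \<in> J" "s \<in> J" "u \<noteq> s"
      using JK K u(2) s(2) by (auto simp: J_def)
    have Ej: "(?E has_real_derivative E' r) (at r within J)" if "r \<in> J" for r
      using E J(1) that DERIV_subset by blast
    have E0: "E' r = 0" if r: "r \<in> J - {s}" for r
    proof -
      have "dist u r < dist u s"
        using r by (auto simp: J_def closed_segment_eq_real_ivl dist_real_def split: if_splits)
      then have "\<rho>' r \<noteq> 0" using near[of r] r JK by (auto simp: Z_def)
      then show ?thesis using zero[of r] J(1) r by auto
    qed
    have const: "?E r = ?E u" if "r \<in> J" for r
    proof (rule has_derivative_zero_unique_strong_convex[where f = ?E and S = J and K = "{s}" and c = u])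
      show "continuous_on J ?E" using Ej by (rule DERIV_continuous_on)
      show "(?E has_derivative (\<lambda>h. 0)) (at r within J)" if "r \<in> J - {s}" for r
        using Ej[of r] E0[OF that] that by (auto simp: has_field_derivative_def lambda_zero)
    qed (use J that in \<open>auto simp: J_def\<close>)
    \<comment> \<open>the derivative at \<open>s\<close> is determined by its one-sided restriction to \<open>J\<close>\<close>
    have "(?E has_real_derivative 0) (at s within J)"
      by (rule has_field_derivative_transform_within[OF DERIV_const zero_less_one J(3)])
        (use const in auto)
    then have "E' s = 0"
      using has_real_derivative_unique_connected[OF _ Ej[OF J(3)] _ J(3) J(2)] J(4)
      by (auto simp: J_def)
    moreover have sI: "s \<in> ?I" using J by auto
    then have "E' s = - 2 * m * (sin (\<rho> s))\<^sup>2 / s ^ 3"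
      using has_real_derivative_unique_connected[OF E[OF sI]
          radial_energy_has_derivative[of s \<rho> \<rho>', OF sI \<rho>[OF sI] \<rho>'[OF sI]] _ sI, of "s / 2"] s(2)
      by auto
    ultimately have "m * (sin (\<rho> s))\<^sup>2 = 0" using sI by auto
    then have "?E s = 0" using s(2) by (auto simp: radial_energy_def)
    then have "(\<rho>' u)\<^sup>2 + m / u\<^sup>2 * (sin (\<rho> u))\<^sup>2 = 0"
      using const[OF J(3)] by (simp add: radial_energy_def)
    moreover have "m / u\<^sup>2 * (sin (\<rho> u))\<^sup>2 \<ge> 0" using m by simp
    ultimately have "(\<rho>' u)\<^sup>2 \<le> 0" by linarith
    then show False using u(2) by simp
  qed
qed

section \<open>Infinity-harmonic rotationally symmetric maps\<close>

theorem theorem5p1: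
  fixes \<phi> :: "real ^ 'n \<Rightarrow> (real ^ 'n) \<times> real"
    and \<rho> :: "real \<Rightarrow> real"
  assumes "C2_on \<phi> punctured_ball"
    and "continuous_on {0<..1} \<rho>"
    and "\<And>r \<theta>. r \<in> {0<..1} \<Longrightarrow> \<theta> \<in> sphere 0 1 \<Longrightarrow> \<phi> (r *\<^sub>R \<theta>) = geodesic_point (\<rho> r) \<theta>"
    and "\<rho> 1 = pi / 2"
  shows "infinity_harmonic punctured_ball (sphere 0 1) \<phi> \<longleftrightarrow>
     ((\<forall>r\<in>{0<..1}. \<rho> r = pi / 2) \<and>
      \<phi> ` punctured_ball \<subseteq> embed_Rn ` sphere 0 1 \<and>
      (\<forall>x\<in>punctured_ball. \<phi> x = embed_Rn (x /\<^sub>R norm x)))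
     \<or>
     ((\<exists>\<rho>' c. \<forall>r\<in>{0<..1}.
          (\<rho> has_real_derivative \<rho>' r) (at r within {0<..1}) \<and>
          (\<rho>' r)\<^sup>2 + (real CARD('n) - 1) / r\<^sup>2 * (sin (\<rho> r))\<^sup>2 = c) \<and>
      (\<exists>k. \<forall>x\<in>punctured_ball. energy_density punctured_ball \<phi> x = k))"
  (is "?H \<longleftrightarrow> ?A \<or> ?B")
proof -
  let ?I = "{0<..1::real}"
  let ?m = "real CARD('n) - 1"
  obtain \<rho>' \<rho>'' where \<rho>: "\<And>r. r \<in> ?I \<Longrightarrow> (\<rho> has_real_derivative \<rho>' r) (at r within ?I)"
    and \<rho>': "\<And>r. r \<in> ?I \<Longrightarrow> (\<rho>' has_real_derivative \<rho>'' r) (at r within ?I)"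
    using profile_twice_differentiable[OF assms(1-3)] by blast
  define E' where "E' r = 2 * \<rho>' r * \<rho>'' r + 2 * ?m * sin (\<rho> r) * cos (\<rho> r) * \<rho>' r / r\<^sup>2
      - 2 * ?m * (sin (\<rho> r))\<^sup>2 / r ^ 3" for r
  have E: "(radial_energy ?m \<rho> \<rho>' has_real_derivative E' r) (at r within ?I)" if "r \<in> ?I" for r
    unfolding E'_def using that \<rho> \<rho>' by (intro radial_energy_has_derivative) auto
  have \<phi>: "\<phi> y = geodesic_point (\<rho> (norm y)) (y /\<^sub>R norm y)" if "y \<in> punctured_ball" for y
    using assms(3)[of "norm y" "y /\<^sub>R norm y"] that by simp
  have dens: "energy_density punctured_ball \<phi> y = radial_energy ?m \<rho> \<rho>' (norm y)"
    if "y \<in> punctured_ball" for y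
    by (rule energy_density_symmetric_map) (use that \<phi> \<rho> in auto)
  have H: "?H \<longleftrightarrow> (\<forall>r\<in>?I. \<rho>' r * E' r = 0)"
    by (rule infinity_harmonic_symmetric_map_iff[OF assms(1) \<phi> \<rho> E])
  have "?m \<ge> 0" by (simp add: Suc_leI)
  have unique: "a = b" if "(f has_real_derivative a) (at r within ?I)"
    "(f has_real_derivative b) (at r within ?I)" "r \<in> ?I" for f a b r
    using has_real_derivative_unique_connected[OF that(1,2) _ that(3), of "r / 2"] that(3) by auto
  have const: "d = 0" if f: "(f has_real_derivative d) (at r within ?I)" and "\<forall>r\<in>?I. f r = c" "r \<in> ?I"
    for f d c r
  proof (rule unique[OF f _ that(3)])
    show "(f has_real_derivative 0) (at r within ?I)"
      by (rule has_field_derivative_transform_within[OF DERIV_const zero_less_one that(3)])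
        (use that in auto)
  qed
  show ?thesis
  proof
    assume ?H
    then consider "\<forall>r\<in>?I. \<rho>' r = 0" | c where "\<forall>r\<in>?I. radial_energy ?m \<rho> \<rho>' r = c"
      using constant_profile_or_constant_energy[OF \<rho> \<rho>' E] H \<open>?m \<ge> 0\<close> by blast
    then show "?A \<or> ?B"
    proof cases
      case 1
      then have "\<And>r. r \<in> ?I \<Longrightarrow> (\<rho> has_real_derivative 0) (at r within ?I)"
        using \<rho> by metis
      then obtain c where c: "\<forall>r\<in>?I. \<rho> r = c"
        using has_field_derivative_zero_constant[of ?I \<rho>] by auto
      then have half: "\<forall>r\<in>?I. \<rho> r = pi / 2" using assms(4) by force
      have "\<phi> x = embed_Rn (x /\<^sub>R norm x)" if "x \<in> punctured_ball" for x
      proof -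
        have *: "\<rho> (norm x) = pi / 2" using half that by auto
        show ?thesis
          unfolding \<phi>[OF that] * geodesic_point_def embed_Rn_def by simp
      qed
      then have ?A using half by auto
      then show ?thesis ..
    next
      case 2
      then have "\<forall>r\<in>?I. (\<rho> has_real_derivative \<rho>' r) (at r within ?I) \<and>
          (\<rho>' r)\<^sup>2 + ?m / r\<^sup>2 * (sin (\<rho> r))\<^sup>2 = c"
        using \<rho> unfolding radial_energy_def by blast
      moreover have "\<forall>x\<in>punctured_ball. energy_density punctured_ball \<phi> x = c"
        using 2 dens by auto
      ultimately have ?B by blast
      then show ?thesis ..
    qed
  next
    assume "?A \<or> ?B"
    then show ?H
    proof
      assume ?A
      then have "\<rho>' r = 0" if "r \<in> ?I" for r
        using const[OF \<rho>[OF that] _ that] by blast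
      then show ?H unfolding H by simp
    next
      assume ?B
      then obtain \<sigma> c where \<sigma>: "\<forall>r\<in>?I. (\<rho> has_real_derivative \<sigma> r) (at r within ?I) \<and>
          (\<sigma> r)\<^sup>2 + ?m / r\<^sup>2 * (sin (\<rho> r))\<^sup>2 = c" by blast
      then have "\<forall>r\<in>?I. radial_energy ?m \<rho> \<rho>' r = c"
        using unique \<rho> unfolding radial_energy_def by metis
      then have "E' r = 0" if "r \<in> ?I" for r
        using const[OF E[OF that] _ that] by blast
      then show ?H unfolding H by simp
    qed
  qed
qed

end
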